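(* Let $n\ge 3$ and let $C_n$ be the cycle of order $n$. (i) If $S\in\mathcal{S}_{1,3,4,4}$, then $C_n$ is $\chi_S$-critical if and only if $n\in\{3,5,6,7,9\}$. (ii) If $S\in\mathcal{S}_{1,3,4,5}$, then $C_n$ is $\chi_S$-critical if and only if $n\in\{3,5,6,7,9,10,11,15,17,23\}$. (iii) If $S\in\mathcal{S}_{1,3,5,5}$, then $C_n$ is $\chi_S$-critical if and only if $n\in\{6,10\}$ or $n$ is odd.
   Context: A packing sequence is a non-decreasing infinite sequence $S=(s_1,s_2,\ldots)$ of positive integers. For a graph $G$, a map $\phi\colon V(G)\to\{1,\ldots,k\}$ is an $S$-packing $k$-coloring if any two distinct vertices $u,v$ with $\phi(u)=\phi(v)=i$ satisfy $d_G(u,v) > s_i$; $\chi_S(G)$ is the least such $k$. A graph $G$ is $\chi_S$-critical if $\chi_S(H)<\chi_S(G)$ for every proper subgraph $H$ of $G$. Notation: $\mathcal{S}_{a_1,\ldots,a_m}$ is the set of packing sequences with $s_j=a_j$ for all $j\le m$ (later entries arbitrary subject to being a packing sequence). E.g. $\mathcal{S}_{1,3,4,5}$: $s_1=1,s_2=3,s_3=4,s_4=5$. *)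

theory Defs
  imports Main "HOL-Library.Extended_Nat"
begin

text \<open>Simple undirected graphs: an edge is the two-element set of its endpoints.\<close>

record 'a ugraph =
  verts :: "'a set"
  edges :: "'a set set"

definition simple_graph :: "'a ugraph \<Rightarrow> bool" where
  "simple_graph G \<longleftrightarrow> edges G \<subseteq> {e. e \<subseteq> verts G \<and> card e = 2}"

definition subgraph :: "'a ugraph \<Rightarrow> 'a ugraph \<Rightarrow> bool" where
  "subgraph H G \<longleftrightarrow> simple_graph H \<and> verts H \<subseteq> verts G \<and> edges H \<subseteq> edges G"

definition proper_subgraph :: "'a ugraph \<Rightarrow> 'a ugraph \<Rightarrow> bool" where
  "proper_subgraph H G \<longleftrightarrow> subgraph H G \<and> H \<noteq> G"

definition walk :: "'a ugraph \<Rightarrow> 'a list \<Rightarrow> bool" where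
  "walk G xs \<longleftrightarrow>
     xs \<noteq> [] \<and> set xs \<subseteq> verts G \<and> successively (\<lambda>u v. {u, v} \<in> edges G) xs"

text \<open>The distance is \<open>\<infinity>\<close> between vertices of different components, since the infimum of the
  empty set in \<^typ>\<open>enat\<close> is \<open>\<infinity>\<close>.\<close>

definition graph_dist :: "'a ugraph \<Rightarrow> 'a \<Rightarrow> 'a \<Rightarrow> enat" where
  "graph_dist G u v =
     (INF xs\<in>{xs. walk G xs \<and> hd xs = u \<and> last xs = v}. enat (length xs - 1))"

text \<open>Packing sequences are indexed from 1, as in \<open>s\<^sub>1, s\<^sub>2, \<dots>\<close>; the value at 0 is never used.\<close>

definition packing_sequence :: "(nat \<Rightarrow> nat) \<Rightarrow> bool" where
  "packing_sequence S \<longleftrightarrow> (\<forall>i\<ge>1. 0 < S i) \<and> (\<forall>i j. 1 \<le> i \<and> i \<le> j \<longrightarrow> S i \<le> S j)"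

text \<open>\<open>packing_seqs [a\<^sub>1, \<dots>, a\<^sub>m]\<close> is the set of packing sequences with prefix \<open>a\<^sub>1, \<dots>, a\<^sub>m\<close>;
  list positions count from 0.\<close>

definition packing_seqs :: "nat list \<Rightarrow> (nat \<Rightarrow> nat) set" where
  "packing_seqs as = {S. packing_sequence S \<and> (\<forall>j<length as. S (Suc j) = as ! j)}"

definition packing_coloring :: "(nat \<Rightarrow> nat) \<Rightarrow> nat \<Rightarrow> 'a ugraph \<Rightarrow> ('a \<Rightarrow> nat) \<Rightarrow> bool" where
  "packing_coloring S k G \<phi> \<longleftrightarrow>
     \<phi> ` verts G \<subseteq> {1..k} \<and>
     (\<forall>u\<in>verts G. \<forall>v\<in>verts G. u \<noteq> v \<and> \<phi> u = \<phi> v \<longrightarrow> enat (S (\<phi> u)) < graph_dist G u v)"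

text \<open>The minimum exists for every finite graph, see \<open>packing_coloring_exists\<close> below.\<close>

definition packing_chromatic :: "(nat \<Rightarrow> nat) \<Rightarrow> 'a ugraph \<Rightarrow> nat" where
  "packing_chromatic S G = (LEAST k. \<exists>\<phi>. packing_coloring S k G \<phi>)"

definition packing_critical :: "(nat \<Rightarrow> nat) \<Rightarrow> 'a ugraph \<Rightarrow> bool" where
  "packing_critical S G \<longleftrightarrow>
     (\<forall>H. proper_subgraph H G \<longrightarrow> packing_chromatic S H < packing_chromatic S G)"

definition cycle_graph :: "nat \<Rightarrow> nat ugraph" where
  "cycle_graph n = \<lparr>verts = {0..<n}, edges = {{i, (i + 1) mod n} |i. i < n}\<rparr>"

lemma packing_coloring_exists:
  assumes "finite (verts G)"
  shows "\<exists>k \<phi>. packing_coloring S k G \<phi>"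
proof -
  obtain f where f: "bij_betw f (verts G) {1..card (verts G)}"
    using finite_same_card_bij[OF assms, of "{1..card (verts G)}"] by auto
  then have "packing_coloring S (card (verts G)) G f"
    unfolding packing_coloring_def bij_betw_def by (auto dest: inj_onD)
  then show ?thesis by blast
qed

lemma simple_graph_cycle_graph:
  assumes "n \<ge> 3"
  shows "simple_graph (cycle_graph n)"
  unfolding simple_graph_def
proof
  fix e assume "e \<in> edges (cycle_graph n)"
  then obtain i where i: "i < n" "e = {i, (i + 1) mod n}"
    unfolding cycle_graph_def by fastforce
  have "(i + 1) mod n \<noteq> i"
  proof (cases "i + 1 = n")
    case True
    then show ?thesis using assms by simp
  next
    case False
    then have "(i + 1) mod n = i + 1" using i(1) by (intro mod_less) linarith
    then show ?thesis by linarith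
  qed
  then have "card e = 2"
    unfolding i(2) by (metis card_2_iff)
  moreover have "e \<subseteq> {0..<n}"
    using i assms by (simp del: mod_less)
  ultimately show "e \<in> {e. e \<subseteq> verts (cycle_graph n) \<and> card e = 2}"
    unfolding cycle_graph_def by simp
qed

end

theory Submission
  imports Defs
begin

text \<open>A proper subgraph of \<open>C\<^sub>n\<close> misses an edge, hence is laid out along a path, so \<open>C\<^sub>n\<close> is
  critical iff it needs more colours than the path on \<open>n\<close> vertices. Paths take at most 4 colours
  (\<open>12131214\<dots>\<close>), and exactly 4 from 8 vertices on. For \<open>n \<ge> 8\<close> the question is thus whether \<open>C\<^sub>n\<close> has
  a 4-colouring. Such colourings arise by concatenating blocks of lengths 6 and 8, together with
  5 for \<open>1,3,4,4\<close> and 13 for \<open>1,3,4,5\<close>. The finitely many exceptions are refuted by search, and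
  the odd cycles for \<open>1,3,5,5\<close> because there the colour 1 must alternate with the other colours.\<close>

section \<open>Distances and packing chromatic numbers\<close>

text \<open>Along any walk from \<open>u\<close> to \<open>v\<close> the potential \<open>f\<close>
  drops by at most one per edge and ends at 0, so the walk has at least \<open>f u\<close> edges. If
  there is no walk, the distance is infinite and the bound is trivial.\<close>

lemma graph_dist_ge:
  fixes f :: "'a \<Rightarrow> nat"
  assumes lipschitz: "\<And>x y. {x, y} \<in> edges G \<Longrightarrow> f x \<le> f y + 1" and "f v = 0"
  shows "enat (f u) \<le> graph_dist G u v"
proof -
  have "f (hd xs) \<le> f (last xs) + (length xs - 1)" if "walk G xs" for xs
    using that
  proof (induction xs rule: induct_list012)
    case (3 x y zs)
    then have "f x \<le> f y + 1" "walk G (y # zs)"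
      using lipschitz by (auto simp: walk_def)
    then show ?case
      using "3.IH"(2) by auto
  qed (auto simp: walk_def)
  then show ?thesis
    unfolding graph_dist_def using assms(2) by (intro INF_greatest) fastforce
qed

lemma graph_dist_le:
  assumes "\<And>i. i \<le> d \<Longrightarrow> p i \<in> verts G" and "\<And>i. i < d \<Longrightarrow> {p i, p (Suc i)} \<in> edges G"
  shows "graph_dist G (p 0) (p d) \<le> enat d"
proof -
  have "walk G (map p [0..<Suc d])"
    unfolding walk_def
    using assms by (auto simp: successively_conv_nth simp del: upt_Suc)
  moreover have "hd (map p [0..<Suc d]) = p 0" "last (map p [0..<Suc d]) = p d"
    by (simp_all add: hd_map del: upt_Suc) simp
  ultimately show ?thesis
    unfolding graph_dist_def by (intro INF_lower2[of "map p [0..<Suc d]"]) auto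
qed

lemma packing_coloring_mono:
  "packing_coloring S j G \<phi> \<Longrightarrow> j \<le> k \<Longrightarrow> packing_coloring S k G \<phi>"
  unfolding packing_coloring_def by fastforce

lemma packing_chromatic_le: "packing_coloring S k G \<phi> \<Longrightarrow> packing_chromatic S G \<le> k"
  unfolding packing_chromatic_def by (blast intro: Least_le)

text \<open>Finiteness supplies some colouring, so the minimum is attained; a minimum of at most
  \<open>k\<close> would then give a colouring with \<open>k\<close> colours.\<close>

lemma packing_chromatic_gt:
  assumes "finite (verts G)" and "\<And>\<phi>. \<not> packing_coloring S k G \<phi>"
  shows "k < packing_chromatic S G"
proof -
  obtain \<phi> where "packing_coloring S (packing_chromatic S G) G \<phi>"
    unfolding packing_chromatic_def using LeastI_ex[OF packing_coloring_exists[OF assms(1)]]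
    by blast
  then show ?thesis
    using packing_coloring_mono assms(2) by (metis not_le)
qed

section \<open>Lower bounds by exhaustive search\<close>

text \<open>With \<open>N = M\<close> this is the packing condition on the cycle of order \<open>M\<close>. Once \<open>M - N\<close> is at
  least every bound \<open>s c\<close>, the last conjunct is void and only the condition on a path remains.\<close>

definition partial_packing :: "(nat \<Rightarrow> nat) \<Rightarrow> nat \<Rightarrow> nat \<Rightarrow> (nat \<Rightarrow> nat) \<Rightarrow> bool" where
  "partial_packing s M N g \<longleftrightarrow>
     (\<forall>i j. i < j \<and> j < N \<and> g i = g j \<longrightarrow> s (g i) < j - i \<and> s (g i) < M - (j - i))"

text \<open>Backtracking search on the cycle whose order is \<open>length w + length css + q\<close>: the word \<open>w\<close>
  lists the colours chosen so far, latest first, and \<open>css\<close> the colours allowed at the next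
  positions.\<close>

fun extendable :: "nat list \<Rightarrow> nat \<Rightarrow> nat list list \<Rightarrow> nat list \<Rightarrow> bool" where
  "extendable s q [] w \<longleftrightarrow> True"
| "extendable s q (cs # css) w \<longleftrightarrow>
     (\<exists>c\<in>set cs. c \<notin> set (take (s ! c) w) \<and>
        c \<notin> set (take (s ! c - (q + length css)) (rev w)) \<and> extendable s q css (c # w))"

text \<open>The search succeeds by following \<open>g\<close> itself, so a failing search refutes
  every colouring. The prefix length \<open>m\<close> is general for the sake of the induction on
  \<open>css\<close>.\<close>

lemma extendable_prefix:
  assumes "partial_packing ((!) s) (m + length css + q) (m + length css) g"
    and "\<forall>i<length css. g (m + i) \<in> set (css ! i)"
  shows "extendable s q css (rev (map g [0..<m]))"
  using assms
proof (induction css arbitrary: m)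
  case (Cons cs css)
  define c where "c = g m"
  have pack: "s ! c < m - i \<and> s ! c < m + length (cs # css) + q - (m - i)" if "i < m" "g i = c" for i
    using Cons.prems(1) that unfolding partial_packing_def c_def by fastforce
  have "c \<in> set cs"
    using Cons.prems(2)[rule_format, of 0] by (simp add: c_def)
  \<comment> \<open>Entry \<open>d\<close> of the reversed word is the colour \<open>d + 1\<close>
    steps back.\<close>
  moreover have "c \<notin> set (take (s ! c) (rev (map g [0..<m])))"
  proof
    assume "c \<in> set (take (s ! c) (rev (map g [0..<m])))"
    then obtain d where "d < s ! c" "d < m" "c = rev (map g [0..<m]) ! d"
      by (auto simp: in_set_conv_nth)
    then show False
      using pack[of "m - Suc d"] by (auto simp: rev_nth)
  qed
  \<comment> \<open>Going forward from position \<open>m\<close> around the cycle to position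
    \<open>i\<close> takes \<open>i + 1 + length css + q\<close> steps; this exceeds
    \<open>s ! c\<close> iff \<open>i\<close> lies beyond the entries taken here.\<close>
  moreover have "c \<notin> set (take (s ! c - (q + length css)) (rev (rev (map g [0..<m]))))"
  proof
    assume "c \<in> set (take (s ! c - (q + length css)) (rev (rev (map g [0..<m]))))"
    then obtain i where "i < s ! c - (q + length css)" "i < m" "c = g i"
      by (auto simp: in_set_conv_nth)
    then show False
      using pack[of i] by auto
  qed
  moreover have "extendable s q css (rev (map g [0..<Suc m]))"
  proof (rule Cons.IH)
    show "\<forall>i<length css. g (Suc m + i) \<in> set (css ! i)"
      using Cons.prems(2) by auto
  qed (use Cons.prems(1) in simp)
  ultimately show ?case
    by (auto simp: c_def)
qed simp

lemmas extendableI = extendable_prefix[where m = 0, simplified]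

text \<open>Reading indices modulo \<open>n\<close> turns both arcs between two vertices into
  forward walks, whose lengths bound the distance from above.\<close>

lemma cycle_coloring_lift:
  assumes "packing_coloring S k (cycle_graph n) \<phi>" and "n \<ge> 1"
  shows "\<phi> (i mod n) \<in> {1..k}"
    and "0 < d \<Longrightarrow> d < n \<Longrightarrow> d \<le> S (\<phi> (i mod n)) \<Longrightarrow> \<phi> ((i + d) mod n) \<noteq> \<phi> (i mod n)"
proof -
  have verts: "j mod n \<in> verts (cycle_graph n)" for j
    using assms(2) by (simp add: cycle_graph_def)
  then show "\<phi> (i mod n) \<in> {1..k}"
    using assms(1) unfolding packing_coloring_def by blast
  assume d: "0 < d" "d < n" "d \<le> S (\<phi> (i mod n))"
  have "{(i + j) mod n, (i + Suc j) mod n} \<in> edges (cycle_graph n)" for j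
    using assms(2) unfolding cycle_graph_def
    by (auto intro!: exI[of _ "(i + j) mod n"] simp: mod_Suc_eq)
  then have "graph_dist (cycle_graph n) (i mod n) ((i + d) mod n) \<le> enat d"
    using graph_dist_le[of d "\<lambda>j. (i + j) mod n" "cycle_graph n"] verts by simp
  moreover have "i mod n \<noteq> (i + d) mod n"
  proof
    assume "i mod n = (i + d) mod n"
    then have "n dvd d"
      by (metis add_diff_cancel_left' le_add1 mod_eq_dvd_iff_nat)
    then show False
      using d by (auto dest: dvd_imp_le)
  qed
  ultimately show "\<phi> ((i + d) mod n) \<noteq> \<phi> (i mod n)"
    using assms(1) verts d(3) unfolding packing_coloring_def
    by (metis enat_ord_simps(2) leD order.strict_trans2)
qed

lemma cycle_coloring_partial_packing:
  assumes "packing_coloring S k (cycle_graph n) \<phi>" and "n \<ge> 1"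
  shows "partial_packing S n n \<phi>"
  unfolding partial_packing_def
proof (intro allI impI; elim conjE)
  fix i j assume ij: "i < j" "j < n" "\<phi> i = \<phi> j"
  show "S (\<phi> i) < j - i \<and> S (\<phi> i) < n - (j - i)"
  proof (rule ccontr)
    assume "\<not> ?thesis"
    then consider "j - i \<le> S (\<phi> i)" | "n - (j - i) \<le> S (\<phi> i)"
      by linarith
    then show False
    proof cases
      case 1
      then have "\<phi> ((i + (j - i)) mod n) \<noteq> \<phi> (i mod n)"
        using ij by (intro cycle_coloring_lift(2)[OF assms]) auto
      then show False
        using ij by simp
    next
      case 2
      \<comment> \<open>Walking on from \<open>j\<close> past the end of the cycle reaches
        \<open>i\<close> after \<open>n - (j - i)\<close> steps.\<close>
      then have "\<phi> ((j + (n - (j - i))) mod n) \<noteq> \<phi> (j mod n)"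
        using ij by (intro cycle_coloring_lift(2)[OF assms]) auto
      moreover have "j + (n - (j - i)) = i + n"
        using ij by simp
      ultimately show False
        using ij by simp
    qed
  qed
qed

lemma partial_packing_cong:
  assumes "partial_packing S M N g" and "\<And>i. i < N \<Longrightarrow> S (g i) = s (g i)"
  shows "partial_packing s M N g"
  using assms unfolding partial_packing_def by fastforce

text \<open>With \<open>q = 0\<close> the search word closes up to the whole cycle. Entry 0 of
  \<open>s\<close> is a placeholder, since colours start at 1.\<close>

lemma cycle_chromatic_gt:
  assumes "\<not> extendable s 0 (replicate n [1..<Suc k]) []"
    and "n \<ge> 1" and "\<And>c. c \<in> {1..k} \<Longrightarrow> S c = s ! c"
  shows "k < packing_chromatic S (cycle_graph n)"
proof (rule packing_chromatic_gt)
  show "\<not> packing_coloring S k (cycle_graph n) \<phi>" for \<phi>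
  proof
    assume \<phi>: "packing_coloring S k (cycle_graph n) \<phi>"
    have colors: "\<phi> i \<in> {1..k}" if "i < n" for i
      using cycle_coloring_lift(1)[OF \<phi> assms(2), of i] that by simp
    have "partial_packing ((!) s) n n \<phi>"
      by (rule partial_packing_cong[OF cycle_coloring_partial_packing[OF \<phi> assms(2)]])
        (use assms(3) colors in blast)
    then have "extendable s 0 (replicate n [1..<Suc k]) []"
      using colors by (intro extendableI) (auto simp: less_Suc_eq_le simp del: upt_Suc)
    then show False
      using assms(1) by blast
  qed
qed (simp add: cycle_graph_def)

definition path_graph :: "nat \<Rightarrow> nat ugraph" where
  "path_graph m = \<lparr>verts = {0..<m}, edges = {{i, i + 1} |i. i + 1 < m}\<rparr>"

text \<open>The closing edge \<open>{n - 1, 0}\<close> separates the two graphs; for two vertices it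
  would coincide with a path edge.\<close>

lemma proper_subgraph_path_cycle:
  assumes "m \<le> n" and "n \<ge> 3"
  shows "proper_subgraph (path_graph m) (cycle_graph n)"
proof -
  have "{n - 1, 0} \<in> edges (cycle_graph n)"
    using assms by (auto simp: cycle_graph_def intro!: exI[of _ "n - 1"])
  moreover have "{n - 1, 0} \<notin> edges (path_graph m)"
    using assms by (auto simp: path_graph_def doubleton_eq_iff)
  ultimately have "path_graph m \<noteq> cycle_graph n"
    by metis
  moreover have "subgraph (path_graph m) (cycle_graph n)"
    unfolding subgraph_def simple_graph_def
    using assms(1) by (fastforce simp: path_graph_def cycle_graph_def)
  ultimately show ?thesis
    by (simp add: proper_subgraph_def)
qed

text \<open>Adding \<open>q\<close> phantom positions, with \<open>q\<close> at least every bound,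
  makes every way around longer than the bounds, so the cyclic search decides the path.\<close>

lemma path_chromatic_gt:
  assumes "\<not> extendable s q (replicate m [1..<Suc k]) []"
    and "\<And>c. c \<in> {1..k} \<Longrightarrow> S c = s ! c \<and> s ! c \<le> q"
  shows "k < packing_chromatic S (path_graph m)"
proof (rule packing_chromatic_gt)
  show "\<not> packing_coloring S k (path_graph m) \<phi>" for \<phi>
  proof
    assume \<phi>: "packing_coloring S k (path_graph m) \<phi>"
    then have colors: "\<phi> i \<in> {1..k}" if "i < m" for i
      using that unfolding packing_coloring_def path_graph_def by (simp add: image_subset_iff)
    have "partial_packing ((!) s) (m + q) m \<phi>"
      unfolding partial_packing_def
    proof (intro allI impI; elim conjE)
      fix i j assume ij: "i < j" "j < m" "\<phi> i = \<phi> j"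
      have "graph_dist (path_graph m) (i + 0) (i + (j - i)) \<le> enat (j - i)"
        by (rule graph_dist_le) (use ij in \<open>auto simp: path_graph_def\<close>)
      moreover have "enat (S (\<phi> i)) < graph_dist (path_graph m) i j"
        using \<phi> ij unfolding packing_coloring_def path_graph_def by auto
      ultimately have "enat (S (\<phi> i)) < enat (j - i)"
        using ij by (metis add_0_right le_add_diff_inverse less_imp_le order.strict_trans2)
      then show "s ! \<phi> i < j - i \<and> s ! \<phi> i < m + q - (j - i)"
        using assms(2)[OF colors, of i] ij by auto
    qed
    then have "extendable s q (replicate m [1..<Suc k]) []"
      using colors by (intro extendableI) (auto simp: less_Suc_eq_le simp del: upt_Suc)
    then show False
      using assms(1) by blast
  qed
qed (simp add: path_graph_def)

section \<open>Proper subgraphs of cycles\<close>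

text \<open>A subgraph contains the endpoints of its edges, so one with all edges of the cycle also
  has all its vertices; deleting a vertex thus loses an edge too.\<close>

lemma proper_subgraph_missing_edge:
  assumes "proper_subgraph H (cycle_graph n)"
  shows "\<exists>e<n. {e, (e + 1) mod n} \<notin> edges H"
proof (rule ccontr)
  assume "\<not> ?thesis"
  then have all: "{e, (e + 1) mod n} \<in> edges H" if "e < n" for e
    using that by blast
  have sub: "subgraph H (cycle_graph n)"
    using assms by (simp add: proper_subgraph_def)
  have "edges H = edges (cycle_graph n)"
    using all sub by (auto simp: subgraph_def cycle_graph_def)
  moreover have "e \<in> verts H" if "e < n" for e
    using all[OF that] sub by (auto simp: subgraph_def simple_graph_def)
  then have "verts H = verts (cycle_graph n)"
    using sub by (auto simp: subgraph_def cycle_graph_def)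
  ultimately have "H = cycle_graph n"
    by simp
  then show False
    using assms by (simp add: proper_subgraph_def)
qed

text \<open>Cutting the cycle at a missing edge lays the subgraph out along a path.\<close>

lemma proper_subgraph_chromatic_le:
  assumes H: "proper_subgraph H (cycle_graph n)"
    and colors: "\<And>i. i < n \<Longrightarrow> g i \<in> {1..k}"
    and pack: "\<And>i j. i < j \<Longrightarrow> j < n \<Longrightarrow> g i = g j \<Longrightarrow> S (g i) < j - i"
  shows "packing_chromatic S H \<le> k"
proof -
  obtain e where e: "e < n" "{e, (e + 1) mod n} \<notin> edges H"
    using proper_subgraph_missing_edge[OF H] by blast
  \<comment> \<open>Positions along the path run from 0 at the vertex after \<open>e\<close> to
    \<open>n - 1\<close> at \<open>e\<close> itself.\<close>
  define pos where "pos v = (if e < v then v - Suc e else v + n - Suc e)" for v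
  have verts: "v < n" if "v \<in> verts H" for v
    using H that by (auto simp: proper_subgraph_def subgraph_def cycle_graph_def)
  have pos_less: "pos v < n" if "v < n" for v
    using that e by (auto simp: pos_def)
  have pos_inj: "u = v" if "pos u = pos v" "u < n" "v < n" for u v
    using that e by (auto simp: pos_def split: if_splits)
  have pos_Suc: "pos ((i + 1) mod n) = pos i + 1" if "i < n" "i \<noteq> e" for i
    using that e by (cases "i + 1 = n") (auto simp: pos_def)
  have adjacent: "pos x = pos y + 1 \<or> pos y = pos x + 1" if "{x, y} \<in> edges H" for x y
  proof -
    have "{x, y} \<in> edges (cycle_graph n)"
      using H that unfolding proper_subgraph_def subgraph_def by blast
    then obtain i where i: "i < n" "{x, y} = {i, (i + 1) mod n}"
      unfolding cycle_graph_def by auto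
    then have "i \<noteq> e"
      using that e by auto
    with i show ?thesis
      using pos_Suc[of i] by (auto simp: doubleton_eq_iff)
  qed
  \<comment> \<open>The sum of the two truncated differences is the absolute difference of
    positions, which changes by at most one along an edge of \<open>H\<close>.\<close>
  have dist: "enat ((pos u - pos v) + (pos v - pos u)) \<le> graph_dist H u v" for u v
    by (rule graph_dist_ge[where f = "\<lambda>u. (pos u - pos v) + (pos v - pos u)"])
      (use adjacent in fastforce)+
  have "packing_coloring S k H (\<lambda>v. g (pos v))"
    unfolding packing_coloring_def
  proof (intro conjI ballI impI; (elim conjE)?)
    show "(\<lambda>v. g (pos v)) ` verts H \<subseteq> {1..k}"
      using verts pos_less colors by blast
    fix u v assume uv: "u \<in> verts H" "v \<in> verts H" "u \<noteq> v" "g (pos u) = g (pos v)"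
    have "S (g (pos u)) < (pos u - pos v) + (pos v - pos u)"
      using uv pack[of "pos u" "pos v"] pack[of "pos v" "pos u"] verts pos_less pos_inj
      by (cases "pos u" "pos v" rule: linorder_cases) auto
    then show "enat (S (g (pos u))) < graph_dist H u v"
      using dist[of u v] by (meson enat_ord_simps(2) order.strict_trans2)
  qed
  then show ?thesis
    by (rule packing_chromatic_le)
qed

text \<open>The word \<open>12131214\<dots>\<close> of period 8.\<close>

definition path_color :: "nat \<Rightarrow> nat" where
  "path_color i = (if even i then 1 else if i mod 4 = 1 then 2 else if i mod 8 = 3 then 3 else 4)"

text \<open>The colour classes are residue classes modulo 2, 4, 8 and 8, so equal colours are at
  least that far apart.\<close>

lemma path_color_packing:
  assumes "S 1 = 1" "S 2 = 3" "S 3 \<le> 5" "S 4 \<le> 5"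
    and "i < j" and "path_color i = path_color j"
  shows "S (path_color i) < j - i"
proof -
  have mod7: "k mod 8 = 7" if "path_color k = 4" for k
    using that unfolding path_color_def by (simp split: if_splits) presburger
  consider "path_color i = 1" "even i" "even j"
    | "path_color i = 2" "i mod 4 = 1" "j mod 4 = 1"
    | "path_color i = 3" "i mod 8 = 3" "j mod 8 = 3"
    | "path_color i = 4" "i mod 8 = 7" "j mod 8 = 7"
    using assms(6) mod7[of i] mod7[of j] unfolding path_color_def by (auto split: if_splits)
  then show ?thesis
  proof cases
    case 1
    then have "2 \<le> j - i"
      using assms(5) by presburger
    then show ?thesis
      using 1 assms(1) by simp
  next
    case 2
    then have "4 \<le> j - i"
      using assms(5) by presburger
    then show ?thesis
      using 2 assms(2) by simp
  next
    case 3
    then have "8 \<le> j - i"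
      using assms(5) by presburger
    then show ?thesis
      using 3 assms(3) by simp
  next
    case 4
    then have "8 \<le> j - i"
      using assms(5) by presburger
    then show ?thesis
      using 4 assms(4) by simp
  qed
qed

text \<open>Every proper subgraph takes the colours of the periodic word, in which colour 3 first
  occurs at index 3 and colour 4 at index 7. Hence the three cases for \<open>k\<close>.\<close>

lemma packing_critical_cycle:
  assumes S: "S 1 = 1" "S 2 = 3" "S 3 \<le> 5" "S 4 \<le> 5"
    and "k < packing_chromatic S (cycle_graph n)"
    and "k = 4 \<or> k = 3 \<and> n \<le> 7 \<or> k = 2 \<and> n \<le> 3"
  shows "packing_critical S (cycle_graph n)"
  unfolding packing_critical_def
proof (intro allI impI)
  fix H assume H: "proper_subgraph H (cycle_graph n)"
  have colors: "path_color i \<in> {1..k}" if "i < n" for i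
  proof -
    have "path_color i \<in> {1..4}" "i < 7 \<Longrightarrow> path_color i \<le> 3" "i < 3 \<Longrightarrow> path_color i \<le> 2"
      unfolding path_color_def by (simp_all, presburger+)
    then show ?thesis
      using assms(6) that by auto
  qed
  then have "packing_chromatic S H \<le> k"
    by (intro proper_subgraph_chromatic_le[OF H]) (use colors path_color_packing[OF S] in blast)+
  then show "packing_chromatic S H < packing_chromatic S (cycle_graph n)"
    using assms(5) by simp
qed

section \<open>Colourings of cycles from blocks\<close>

fun packed :: "(nat \<Rightarrow> nat) \<Rightarrow> nat list \<Rightarrow> bool" where
  "packed s [] \<longleftrightarrow> True"
| "packed s (x # xs) \<longleftrightarrow> x \<notin> set (take (s x) xs) \<and> packed s xs"

lemma packed_nth:
  "packed s w \<Longrightarrow> i < j \<Longrightarrow> j < length w \<Longrightarrow> w ! i = w ! j \<Longrightarrow> s (w ! i) < j - i"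
proof (induction w arbitrary: i j)
  case (Cons x xs)
  show ?case
  proof (cases i)
    case 0
    then obtain j' where j: "j = Suc j'" "j' < length xs" "xs ! j' = x"
      using Cons.prems by (cases j) auto
    show ?thesis
    proof (rule ccontr)
      assume "\<not> ?thesis"
      then have "j' < s x"
        using 0 j by simp
      then have "x \<in> set (take (s x) xs)"
        using j by (auto simp: in_set_conv_nth)
      then show False
        using Cons.prems(1) by simp
    qed
  next
    case (Suc i')
    then show ?thesis
      using Cons.prems Cons.IH[of i' "j - 1"] by (cases j) auto
  qed
qed simp

text \<open>A letter \<open>x\<close> of \<open>u\<close> constrains only the next
  \<open>s x\<close> letters, and these never reach past \<open>p\<close> into
  \<open>v\<close>.\<close>

lemma packed_glue:
  "packed s (u @ p) \<Longrightarrow> packed s (p @ v) \<Longrightarrow> \<forall>x\<in>set u. s x \<le> length p \<Longrightarrow> packed s (u @ p @ v)"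
  by (induction u) auto

text \<open>Appending \<open>p\<close> unrolls the cycle. A pair \<open>i < j\<close> with
  \<open>i < length p\<close> reappears across the seam as positions \<open>j\<close> and
  \<open>n + i\<close> of \<open>w @ p\<close>; for larger \<open>i\<close> the arc through the seam
  is longer than \<open>p\<close> and hence than any bound.\<close>

lemma cycle_chromatic_le:
  assumes w: "set w \<subseteq> {1..k}" "w = p @ w'" "packed S (w @ p)"
    and short: "\<And>c. c \<in> {1..k} \<Longrightarrow> S c \<le> length p"
  shows "packing_chromatic S (cycle_graph (length w)) \<le> k"
proof -
  define n where "n = length w"
  have pack: "S (w ! i) < j - i \<and> S (w ! i) < n - (j - i)"
    if "i < j" "j < n" "w ! i = w ! j" for i j
  proof
    show "S (w ! i) < j - i"
      using packed_nth[OF w(3), of i j] that by (simp add: n_def nth_append)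
    show "S (w ! i) < n - (j - i)"
    proof (cases "i < length p")
      case True
      then have "(w @ p) ! (n + i) = w ! i"
        using w(2) by (simp add: n_def nth_append)
      then show ?thesis
        using packed_nth[OF w(3), of j "n + i"] that True by (simp add: n_def nth_append)
    next
      case False
      have "w ! i \<in> {1..k}"
        using that by (intro subsetD[OF w(1) nth_mem]) (simp add: n_def)
      then show ?thesis
        using short[of "w ! i"] False that by linarith
    qed
  qed
  \<comment> \<open>This is the distance on the cycle: the shorter of the two arcs.\<close>
  define f where "f v u = min ((u - v) + (v - u)) (n - ((u - v) + (v - u)))" for u v :: nat
  have "f v x \<le> f v y + 1" if edge: "{x, y} \<in> edges (cycle_graph n)" "v < n" for v x y
  proof -
    obtain i where i: "i < n" "{x, y} = {i, (i + 1) mod n}"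
      using edge(1) unfolding cycle_graph_def by auto
    have "(i + 1) mod n = (if i = n - 1 then 0 else i + 1)"
      using i(1) by auto
    then have "x = i \<and> y = (if i = n - 1 then 0 else i + 1) \<or>
        y = i \<and> x = (if i = n - 1 then 0 else i + 1)"
      using i(2) by (auto simp: doubleton_eq_iff)
    then show ?thesis
      using i(1) edge(2) unfolding f_def by (auto split: if_splits) linarith+
  qed
  then have dist: "enat (f v u) \<le> graph_dist (cycle_graph n) u v" if "v < n" for u v
    using that by (intro graph_dist_ge) (auto simp: f_def)
  have "packing_coloring S k (cycle_graph n) ((!) w)"
    unfolding packing_coloring_def
  proof (intro conjI ballI impI; (elim conjE)?)
    show "(!) w ` verts (cycle_graph n) \<subseteq> {1..k}"
      using w(1) by (auto simp: cycle_graph_def n_def)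
    fix u v assume "u \<in> verts (cycle_graph n)" "v \<in> verts (cycle_graph n)"
      and uv: "u \<noteq> v" "w ! u = w ! v"
    then have less: "u < n" "v < n"
      by (auto simp: cycle_graph_def)
    then have "S (w ! u) < f v u"
      using uv pack[of u v] pack[of v u] unfolding f_def
      by (cases u v rule: linorder_cases) auto
    then show "enat (S (w ! u)) < graph_dist (cycle_graph n) u v"
      using dist[of v u] less by (meson enat_ord_simps(2) order.strict_trans2)
  qed
  then show ?thesis
    unfolding n_def by (rule packing_chromatic_le)
qed

text \<open>Blocks that start with the same word \<open>p\<close> can be concatenated, as no bound \<open>S c\<close> reaches
  across \<open>p\<close>.\<close>

definition block_lengths :: "(nat \<Rightarrow> nat) \<Rightarrow> nat \<Rightarrow> nat list \<Rightarrow> nat set" where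
  "block_lengths S k p =
     {length w |w. set w \<subseteq> {1..k} \<and> (\<exists>w'. w = p @ w') \<and> packed S (w @ p)}"

lemma block_lengthsI:
  "set (p @ w) \<subseteq> {1..k} \<Longrightarrow> packed S (p @ w @ p) \<Longrightarrow> n = length (p @ w) \<Longrightarrow>
    n \<in> block_lengths S k p"
  unfolding block_lengths_def by (rule CollectI, rule exI[of _ "p @ w"]) simp

text \<open>As \<open>v\<close> begins with \<open>p\<close>, the words \<open>u @ p\<close> and
  \<open>v @ p\<close> overlap in \<open>p\<close> and can be glued there.\<close>

lemma block_lengths_add:
  assumes "m \<in> block_lengths S k p" "n \<in> block_lengths S k p"
    and short: "\<And>c. c \<in> {1..k} \<Longrightarrow> S c \<le> length p"
  shows "m + n \<in> block_lengths S k p"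
proof -
  obtain u u' v v' where u: "m = length u" "set u \<subseteq> {1..k}" "u = p @ u'" "packed S (u @ p)"
    and v: "n = length v" "set v \<subseteq> {1..k}" "v = p @ v'" "packed S (v @ p)"
    using assms(1,2) unfolding block_lengths_def by blast
  have "packed S (u @ p @ v' @ p)"
    by (rule packed_glue) (use u v short in auto)
  then show ?thesis
    unfolding block_lengths_def using u v by - (rule CollectI, rule exI[of _ "u @ v"], simp)
qed

lemma block_lengths_chromatic_le:
  assumes "n \<in> block_lengths S k p" and "\<And>c. c \<in> {1..k} \<Longrightarrow> S c \<le> length p"
  shows "packing_chromatic S (cycle_graph n) \<le> k"
  using assms cycle_chromatic_le[of _ k p _ S] unfolding block_lengths_def by auto

section \<open>The theorem\<close>

lemma eq_1_2_3_4: "c \<in> {1..4::nat} \<longleftrightarrow> c = 1 \<or> c = 2 \<or> c = 3 \<or> c = 4"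
  by auto

text \<open>The path on eight vertices already needs four colours, so this proper subgraph causes no
  drop.\<close>

lemma not_critical_cycle:
  assumes S: "S 1 = 1" "S 2 = 3" "S 3 = a" "a = 4 \<or> a = 5"
    and "packing_chromatic S (cycle_graph n) \<le> 4" and "n \<ge> 8"
  shows "\<not> packing_critical S (cycle_graph n)"
proof -
  have "\<not> extendable [0, 1, 3, 4] 5 (replicate 8 [1..<Suc 3]) []"
    by code_simp
  moreover have "\<not> extendable [0, 1, 3, 5] 5 (replicate 8 [1..<Suc 3]) []"
    by code_simp
  ultimately have "\<not> extendable [0, 1, 3, a] 5 (replicate 8 [1..<Suc 3]) []"
    using S(4) by metis
  then have "3 < packing_chromatic S (path_graph 8)"
  proof (rule path_chromatic_gt)
    fix c :: nat assume "c \<in> {1..3}"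
    then have "c = 1 \<or> c = 2 \<or> c = 3" by auto
    then show "S c = [0, 1, 3, a] ! c \<and> [0, 1, 3, a] ! c \<le> 5"
      using S by (auto simp: numeral_eq_Suc)
  qed
  moreover have "proper_subgraph (path_graph 8) (cycle_graph n)"
    using assms(6) by (intro proper_subgraph_path_cycle) auto
  ultimately show ?thesis
    using assms(5) unfolding packing_critical_def by fastforce
qed

text \<open>The colouring 1, 2, 1, 3 uses three colours, and the path on four vertices needs as
  many.\<close>

lemma not_critical_cycle_4:
  assumes S: "S 1 = 1" "S 2 = 3" "S 3 \<le> 5"
  shows "\<not> packing_critical S (cycle_graph 4)"
proof -
  have "packing_coloring S 3 (cycle_graph 4) (\<lambda>v. [1, 2, 1, 3] ! v)"
  proof -
    have two: "enat 2 \<le> graph_dist (cycle_graph 4) u v"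
      if "{u, v} = {0, 2}" for u v
    proof -
      \<comment> \<open>The potential is 0 at \<open>v\<close>, 2 at \<open>u\<close> and 1
        elsewhere; it changes by at most one along edges because the opposite vertices
        \<open>u\<close> and \<open>v\<close> are not adjacent. The test \<open>u = u\<close> only
        spells out its value at \<open>u\<close>.\<close>
      have "enat (if u = v then 0 else if u = u then 2 else 1) \<le> graph_dist (cycle_graph 4) u v"
      proof (rule graph_dist_ge[where f = "\<lambda>x. if x = v then 0 else if x = u then 2 else 1"])
        fix x y :: nat assume "{x, y} \<in> edges (cycle_graph 4)"
        then have "{x, y} \<noteq> {u, v}"
          using that by (auto simp: cycle_graph_def doubleton_eq_iff)
        then show "(if x = v then 0 else if x = u then 2 else 1) \<le>
            (if y = v then 0 else if y = u then 2 else 1) + (1::nat)"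
          by auto
      qed simp
      then show ?thesis
        using that by (auto simp: doubleton_eq_iff)
    qed
    have far: "enat (Suc 0) < graph_dist (cycle_graph 4) u v" if "{u, v} = {0, 2}" for u v
      using two[OF that] by (cases "graph_dist (cycle_graph 4) u v") auto
    have verts: "verts (cycle_graph 4) = {0, 1, 2, 3}"
      by (auto simp: cycle_graph_def)
    show ?thesis
      unfolding packing_coloring_def verts using far S(1)
      by (auto simp: numeral_eq_Suc doubleton_eq_iff)
  qed
  then have "packing_chromatic S (cycle_graph 4) \<le> 3"
    by (rule packing_chromatic_le)
  moreover have "\<not> extendable [0, 1, 3] 3 (replicate 4 [1..<Suc 2]) []"
    by code_simp
  then have "2 < packing_chromatic S (path_graph 4)"
  proof (rule path_chromatic_gt)
    fix c :: nat assume "c \<in> {1..2}"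
    then have "c = 1 \<or> c = 2" by auto
    then show "S c = [0, 1, 3] ! c \<and> [0, 1, 3] ! c \<le> (3::nat)"
      using S by (auto simp: numeral_eq_Suc)
  qed
  moreover have "proper_subgraph (path_graph 4) (cycle_graph 4)"
    by (intro proper_subgraph_path_cycle) auto
  ultimately show ?thesis
    unfolding packing_critical_def by fastforce
qed

text \<open>Paths take two colours up to three vertices and three up to seven; the searches show
  that these cycles need more.\<close>

lemma critical_cycle_small:
  assumes S: "S 1 = 1" "S 2 = 3" "S 3 = a" "a = 4 \<or> a = 5" "S 4 \<le> 5" and "n \<in> {3, 5, 6, 7}"
  shows "packing_critical S (cycle_graph n)"
proof (cases "n = 3")
  case True
  have "\<not> extendable [0, 1, 3] 0 (replicate 3 [1..<Suc 2]) []"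
    by code_simp
  then have "2 < packing_chromatic S (cycle_graph 3)"
  proof (rule cycle_chromatic_gt)
    fix c :: nat assume "c \<in> {1..2}"
    then have "c = 1 \<or> c = 2" by auto
    then show "S c = [0, 1, 3] ! c"
      using S by (auto simp: numeral_eq_Suc)
  qed simp
  then show ?thesis
    using True S by (intro packing_critical_cycle[where k = 2]) auto
next
  case False
  have "\<forall>a\<in>{4, 5}. \<forall>n\<in>{5, 6, 7}. \<not> extendable [0, 1, 3, a] 0 (replicate n [1..<Suc 3]) []"
    by code_simp
  then have "\<not> extendable [0, 1, 3, a] 0 (replicate n [1..<Suc 3]) []"
    using False assms(6) S(4) by auto
  then have "3 < packing_chromatic S (cycle_graph n)"
  proof (rule cycle_chromatic_gt)
    fix c :: nat assume "c \<in> {1..3}"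
    then have "c = 1 \<or> c = 2 \<or> c = 3" by auto
    then show "S c = [0, 1, 3, a] ! c"
      using S by (auto simp: numeral_eq_Suc)
  qed (use assms(6) in auto)
  then show ?thesis
    using assms(6) S by (intro packing_critical_cycle[where k = 3]) auto
qed

lemma critical_cycle_search:
  assumes S: "S 1 = 1" "S 2 = 3" "S 3 = a" "S 4 = b" "a \<le> 5" "b \<le> 5"
    and "\<not> extendable [0, 1, 3, a, b] 0 (replicate n [1..<Suc 4]) []" and "n \<ge> 1"
  shows "packing_critical S (cycle_graph n)"
proof -
  have "4 < packing_chromatic S (cycle_graph n)"
    using assms(7,8)
  proof (rule cycle_chromatic_gt)
    fix c :: nat assume "c \<in> {1..4}"
    then show "S c = [0, 1, 3, a, b] ! c"
      using S unfolding eq_1_2_3_4 by (auto simp: numeral_eq_Suc)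
  qed
  then show ?thesis
    using S by (intro packing_critical_cycle[where k = 4]) auto
qed

text \<open>For bounds \<open>1, 3, 5, 5\<close> two consecutive colours other than 1 do not survive in a window of
  length 8, so the colour 1 occupies every other vertex.\<close>

lemma odd_cycle_chromatic_gt:
  assumes S: "S 1 = 1" "S 2 = 3" "S 3 = 5" "S 4 = 5" and n: "n \<ge> 7" "odd n"
  shows "4 < packing_chromatic S (cycle_graph n)"
proof (rule packing_chromatic_gt)
  show "\<not> packing_coloring S 4 (cycle_graph n) \<phi>" for \<phi>
  proof
    assume \<phi>: "packing_coloring S 4 (cycle_graph n) \<phi>"
    define g where "g i = \<phi> (i mod n)" for i
    have colors: "g i \<in> {1..4}" for i
      unfolding g_def using cycle_coloring_lift(1)[OF \<phi>] n by simp
    have S_g: "S (g i) = [0, 1, 3, 5, 5] ! g i \<and> S (g i) \<le> 5" for i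
      using colors[of i] S unfolding eq_1_2_3_4 by (auto simp: numeral_eq_Suc)
    \<comment> \<open>Here \<open>d\<close> is at most 5, hence below \<open>n\<close>.\<close>
    have pack: "g (i + d) \<noteq> g i" if "0 < d" "d \<le> S (g i)" for i d
      using cycle_coloring_lift(2)[OF \<phi>, of d i] that S_g[of i] n unfolding g_def by simp
    have alternating: "g (a + 2) = 1 \<or> g (a + 3) = 1" for a
    proof (rule ccontr)
      assume no1: "\<not> ?thesis"
      let ?A = "[1, 2, 3, 4] :: nat list" and ?B = "[2, 3, 4] :: nat list"
      \<comment> \<open>Indices 2 and 3 carry the two neighbours assumed not to have colour 1. For
        \<open>n = 7\<close> the window returns to its first vertex, but at index distance 7, beyond
        all bounds; the added 5 makes the wraparound test void.\<close>
      let ?css = "[?A, ?A, ?B, ?B, ?A, ?A, ?A, ?A]"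
      have "partial_packing ((!) [0, 1, 3, 5, 5]) (length ?css + 5) (length ?css) (\<lambda>i. g (a + i))"
        unfolding partial_packing_def
      proof (intro allI impI; elim conjE)
        fix i j :: nat assume ij: "i < j" "j < length ?css" "g (a + i) = g (a + j)"
        have "S (g (a + i)) < j - i"
          using pack[of "j - i" "a + i"] ij by (auto simp: not_le[symmetric])
        then show "[0, 1, 3, 5, 5] ! g (a + i) < j - i \<and>
            [0, 1, 3, 5, 5] ! g (a + i) < length ?css + 5 - (j - i)"
          using S_g[of "a + i"] ij by auto
      qed
      moreover have "g (a + i) \<in> set (?css ! i)" if "i < length ?css" for i
      proof -
        have "i \<in> {0, 1, 2, 3, 4, 5, 6, 7}"
          using that by auto
        then show ?thesis
          using colors[of "a + i"] no1 unfolding eq_1_2_3_4 by auto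
      qed
      ultimately have "extendable [0, 1, 3, 5, 5] 5 ?css []"
        by (blast intro: extendableI)
      moreover have "\<not> extendable [0, 1, 3, 5, 5] 5 ?css []"
        by code_simp
      ultimately show False
        by blast
    qed
    have "g (Suc (2 + a)) = 1 \<longleftrightarrow> g (2 + a) \<noteq> 1" for a
      using alternating[of a] pack[of 1 "a + 2"] S(1) by (auto simp: numeral_eq_Suc)
    \<comment> \<open>Membership in colour class 1 flips at each step, so the odd number
      \<open>n\<close> of steps flips it, while periodicity preserves it.\<close>
    then have "g (2 + a) = 1 \<longleftrightarrow> (even a \<longleftrightarrow> g 2 = 1)" for a
      by (induction a) auto
    moreover have "g (2 + n) = g 2"
      by (metis g_def mod_add_self2)
    ultimately show False
      using n(2) by metis
  qed
qed (simp add: cycle_graph_def)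

text \<open>The lengths 12, 14 and 16 are sums of two blocks; further blocks of length 6 reach all
  larger even lengths.\<close>

lemma even_block_lengths:
  assumes "6 \<in> block_lengths S k p" "8 \<in> block_lengths S k p"
    and short: "\<And>c. c \<in> {1..k} \<Longrightarrow> S c \<le> length p"
  shows "even n \<Longrightarrow> n \<ge> 12 \<Longrightarrow> n \<in> block_lengths S k p"
proof (induction n rule: less_induct)
  case (less n)
  note add = block_lengths_add[OF _ _ short]
  show ?case
  proof (cases "n < 18")
    case True
    then have "n = 6 + 6 \<or> n = 6 + 8 \<or> n = 8 + 8"
      using less.prems by presburger
    then show ?thesis
      by (elim disjE ssubst; intro add assms(1,2))
  next
    case False
    then have "n - 6 \<in> block_lengths S k p"
      using less.prems by (intro less.IH) auto
    then show ?thesis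
      using add[where m = 6 and n = "n - 6"] assms(1) False by simp
  qed
qed

text \<open>The lengths 10 to 14 are sums of two blocks; further blocks of length 5 reach the
  rest.\<close>

lemma block_lengths_ge_10:
  assumes "5 \<in> block_lengths S k p" "6 \<in> block_lengths S k p" "8 \<in> block_lengths S k p"
    and short: "\<And>c. c \<in> {1..k} \<Longrightarrow> S c \<le> length p"
  shows "n \<ge> 10 \<Longrightarrow> n \<in> block_lengths S k p"
proof (induction n rule: less_induct)
  case (less n)
  note add = block_lengths_add[OF _ _ short]
  show ?case
  proof (cases "n < 15")
    case True
    then have "n = 5 + 5 \<or> n = 5 + 6 \<or> n = 6 + 6 \<or> n = 5 + 8 \<or> n = 6 + 8"
      using less.prems by presburger
    then show ?thesis
      by (elim disjE ssubst; intro add assms(1-3))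
  next
    case False
    then have "n - 5 \<in> block_lengths S k p"
      using less.prems by (intro less.IH) auto
    then show ?thesis
      using add[where m = 5 and n = "n - 5"] assms(1) False by simp
  qed
qed

section \<open>The blocks and the three families of packing sequences\<close>

lemma packing_seqs_4:
  assumes "S \<in> packing_seqs [1, 3, a, b]"
  shows "S 1 = 1" "S 2 = 3" "S 3 = a" "S 4 = b"
  using assms unfolding packing_seqs_def by (auto simp: numeral_eq_Suc less_Suc_eq)

text \<open>The blocks are 312141 and 31214121, the latter a rotation of the path word. Their common
  prefix has length 5, the largest bound in question.\<close>

lemma block_lengths_6_8:
  assumes S: "S 1 = 1" "S 2 = 3" "S 3 \<in> {4, 5}" "S 4 \<in> {4, 5}"
  shows "6 \<in> block_lengths S 4 [3, 1, 2, 1, 4]" "8 \<in> block_lengths S 4 [3, 1, 2, 1, 4]"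
proof -
  show "6 \<in> block_lengths S 4 [3, 1, 2, 1, 4]"
    by (rule block_lengthsI[of _ "[1]"]) (use S in auto)
  show "8 \<in> block_lengths S 4 [3, 1, 2, 1, 4]"
    by (rule block_lengthsI[of _ "[1, 2, 1]"]) (use S in auto)
qed

lemma critical_cycle_1344:
  assumes S: "S \<in> packing_seqs [1, 3, 4, 4]" and n: "n \<ge> 3"
  shows "packing_critical S (cycle_graph n) \<longleftrightarrow> n \<in> {3, 5, 6, 7, 9}"
proof -
  note S = packing_seqs_4[OF S]
  let ?p = "[3, 1, 2, 1, 4] :: nat list"
  have short: "S c \<le> length ?p" if "c \<in> {1..4}" for c
    using that S unfolding eq_1_2_3_4 by auto
  have blocks: "6 \<in> block_lengths S 4 ?p" "8 \<in> block_lengths S 4 ?p"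
    using block_lengths_6_8 S by auto
  \<comment> \<open>The prefix alone is a block: colours 3 and 4 recur at distance 5, just above
    their bounds.\<close>
  have block5: "5 \<in> block_lengths S 4 ?p"
    by (rule block_lengthsI[of _ "[]"]) (use S in auto)
  have colorable: "packing_chromatic S (cycle_graph n) \<le> 4" if "n = 8 \<or> n \<ge> 10"
  proof (rule block_lengths_chromatic_le[OF _ short])
    show "n \<in> block_lengths S 4 ?p"
      using that blocks(2) block_lengths_ge_10[OF block5 blocks short, of n] by metis
  qed
  have "\<not> extendable [0, 1, 3, 4, 4] 0 (replicate 9 [1..<Suc 4]) []"
    by code_simp
  then have critical: "packing_critical S (cycle_graph 9)"
    using S by (intro critical_cycle_search) auto
  consider "n \<in> {3, 5, 6, 7}" | "n = 9" | "n = 4" | "n = 8 \<or> n \<ge> 10"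
    using n by fastforce
  then show ?thesis
  proof cases
    case 1
    then show ?thesis
      using critical_cycle_small[of S 4 n] S by auto
  next
    case 4
    then show ?thesis
      using not_critical_cycle[of S 4 n] S colorable by auto
  qed (use critical not_critical_cycle_4[of S] S in auto)
qed

lemma critical_cycle_1345:
  assumes S: "S \<in> packing_seqs [1, 3, 4, 5]" and n: "n \<ge> 3"
  shows "packing_critical S (cycle_graph n) \<longleftrightarrow> n \<in> {3, 5, 6, 7, 9, 10, 11, 15, 17, 23}"
proof -
  note S = packing_seqs_4[OF S]
  let ?p = "[3, 1, 2, 1, 4] :: nat list"
  have short: "S c \<le> length ?p" if "c \<in> {1..4}" for c
    using that S unfolding eq_1_2_3_4 by auto
  have blocks: "6 \<in> block_lengths S 4 ?p" "8 \<in> block_lengths S 4 ?p"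
    using block_lengths_6_8 S by auto
  \<comment> \<open>The factor 24 breaks the alternation of colour 1 and so permits odd length;
    across the seam colour 3 recurs at distance 5, which its bound 4 allows.\<close>
  have block13: "13 \<in> block_lengths S 4 ?p"
    by (rule block_lengthsI[of _ "[1, 2, 1, 3, 1, 2, 4, 1]"]) (use S in auto)
  have colorable: "packing_chromatic S (cycle_graph n) \<le> 4"
    if "n \<notin> {9, 10, 11, 15, 17, 23}" "n \<ge> 8"
  proof (rule block_lengths_chromatic_le[OF _ short])
    \<comment> \<open>These are the sums of 6, 8 and 13 from 8 on: an odd one is 13 plus 0, 6, 8 or
      an even number from 12 on.\<close>
    have "n = 8 \<or> even n \<and> n \<ge> 12 \<or> n = 13 \<or> n = 13 + 6 \<or> n = 13 + 8 \<or> odd n \<and> n \<ge> 25"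
      using that by simp presburger
    then consider "n = 8" | "even n" "n \<ge> 12" | "n = 13" | "n = 13 + 6" | "n = 13 + 8"
      | "odd n" "n \<ge> 25"
      by blast
    then show "n \<in> block_lengths S 4 ?p"
    proof cases
      case 6
      then have "n - 13 \<in> block_lengths S 4 ?p"
        by (intro even_block_lengths[OF blocks short]) auto
      then show ?thesis
        using block_lengths_add[OF block13 _ short, of "n - 13"] 6 by simp
    next
      case 2
      then show ?thesis
        using even_block_lengths[OF blocks short] by metis
    next
      case 4
      show ?thesis
        unfolding 4 by (rule block_lengths_add[OF block13 blocks(1) short])
    next
      case 5
      show ?thesis
        unfolding 5 by (rule block_lengths_add[OF block13 blocks(2) short])
    qed (use blocks(2) block13 in simp_all)
  qed
  have "\<forall>n\<in>{9, 10, 11, 15, 17, 23}. \<not> extendable [0, 1, 3, 4, 5] 0 (replicate n [1..<Suc 4]) []"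
    by code_simp
  then have critical: "packing_critical S (cycle_graph n)" if "n \<in> {9, 10, 11, 15, 17, 23}"
    using that S n by (intro critical_cycle_search) auto
  consider "n \<in> {3, 5, 6, 7}" | "n \<in> {9, 10, 11, 15, 17, 23}" | "n = 4"
    | "n \<notin> {9, 10, 11, 15, 17, 23}" "n \<ge> 8"
    using n by fastforce
  then show ?thesis
  proof cases
    case 1
    then show ?thesis
      using critical_cycle_small[of S 4 n] S by auto
  next
    case 4
    then show ?thesis
      using not_critical_cycle[of S 4 n] S colorable by auto
  qed (use critical not_critical_cycle_4[of S] S in auto)
qed

lemma critical_cycle_1355:
  assumes S: "S \<in> packing_seqs [1, 3, 5, 5]" and n: "n \<ge> 3"
  shows "packing_critical S (cycle_graph n) \<longleftrightarrow> n \<in> {6, 10} \<or> odd n"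
proof -
  note S = packing_seqs_4[OF S]
  let ?p = "[3, 1, 2, 1, 4] :: nat list"
  have short: "S c \<le> length ?p" if "c \<in> {1..4}" for c
    using that S unfolding eq_1_2_3_4 by auto
  have blocks: "6 \<in> block_lengths S 4 ?p" "8 \<in> block_lengths S 4 ?p"
    using block_lengths_6_8 S by auto
  have colorable: "packing_chromatic S (cycle_graph n) \<le> 4" if "n = 8 \<or> even n \<and> n \<ge> 12"
  proof (rule block_lengths_chromatic_le[OF _ short])
    show "n \<in> block_lengths S 4 ?p"
      using that blocks(2) even_block_lengths[OF blocks short, of n] by metis
  qed
  \<comment> \<open>The order 10 is the only even one from 8 on that is not a sum of 6s and 8s; odd
    orders need no search here beyond the small ones.\<close>
  have "\<not> extendable [0, 1, 3, 5, 5] 0 (replicate 10 [1..<Suc 4]) []"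
    by code_simp
  then have critical_10: "packing_critical S (cycle_graph 10)"
    using S by (intro critical_cycle_search) auto
  have "n \<in> {3, 5, 6, 7} \<or> n = 10 \<or> n = 4 \<or> odd n \<and> n \<ge> 7 \<or> n = 8 \<or> even n \<and> n \<ge> 12"
    using n by simp presburger
  then consider "n \<in> {3, 5, 6, 7}" | "n = 10" | "n = 4" | "odd n" "n \<ge> 7"
    | "n = 8 \<or> even n \<and> n \<ge> 12"
    by blast
  then show ?thesis
  proof cases
    case 1
    then show ?thesis
      using critical_cycle_small[of S 5 n] S by auto
  next
    case 4
    then show ?thesis
      using packing_critical_cycle[of S 4 n] odd_cycle_chromatic_gt[of S n] S by auto
  next
    case 5
    then show ?thesis
      using not_critical_cycle[of S 5 n] S colorable by auto
  qed (use critical_10 not_critical_cycle_4[of S] S in auto)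
qed

theorem theorem4p2:
  fixes n :: nat
  assumes "n \<ge> 3"
  shows "(\<forall>S\<in>packing_seqs [1, 3, 4, 4].
            packing_critical S (cycle_graph n) \<longleftrightarrow> n \<in> {3, 5, 6, 7, 9}) \<and>
         (\<forall>S\<in>packing_seqs [1, 3, 4, 5].
            packing_critical S (cycle_graph n) \<longleftrightarrow>
              n \<in> {3, 5, 6, 7, 9, 10, 11, 15, 17, 23}) \<and>
         (\<forall>S\<in>packing_seqs [1, 3, 5, 5].
            packing_critical S (cycle_graph n) \<longleftrightarrow> n \<in> {6, 10} \<or> odd n)"
  using critical_cycle_1344[OF _ assms] critical_cycle_1345[OF _ assms]
    critical_cycle_1355[OF _ assms] by blast

end
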